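(* Let $p$ be a prime number and let $G$ be a finite $p$-group. Then the following statements are equivalent: (i) the power graph $\mathcal{P}(G)$ is cyclically separable; (ii) $\partial(G) \geq 3$; (iii) $G$ satisfies one of the following conditions: (a) $p>3$ and $G$ is non-cyclic; (b) $p=3$ and $G$ has at least two maximal cyclic subgroups of order greater than $3$; (c) $p=2$ and either $G$ has at least two maximal cyclic subgroups of order greater than $4$, or $G$ has at least two maximal cyclic subgroups of order greater than $2$ with trivial intersection.
   Context: All graphs are undirected and simple. The power graph $\mathcal{P}(G)$ of a group $G$ is the graph whose vertices are the elements of $G$, two distinct vertices being adjacent if one of them is a power of the other in $G$. For a graph $\Gamma$, a vertex cutset is a set $S$ of vertices such that $\Gamma - S$ is disconnected. A cyclic vertex cutset of $\Gamma$ is a vertex cutset $S$ such that $\Gamma - S$ has at least two components containing cycles. $\Gamma$ is cyclically separable if it has a cyclic vertex cutset. A maximal cyclic subgroup of $G$ is a cyclic subgroup of $G$ not properly contained in any other cyclic subgroup of $G$; $\mathcal{M}(G)$ denotes the set of all maximal cyclic subgroups of $G$. Two subgroups $H_1, H_2$ have trivial intersection if $H_1 \cap H_2 = \{e\}$, where $e$ is the identity element of $G$. For $M, N \in \mathcal{M}(G)$, put $\mathrm{d}(M,N) = \min\{|M \setminus N|, |N \setminus M|\}$. The difference number $\partial(G)$ is the maximum of $\mathrm{d}(M,N)$ as $M$ and $N$ vary over every pair of subgroups in $\mathcal{M}(G)$ (with $M=N$ allowed, so $\partial(G)=0$ when $G$ is finite cyclic). "At least two maximal cyclic subgroups" means at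 least two distinct ones. *)

theory Defs
  imports
    "HOL-Algebra.Elementary_Groups"
    "HOL-Computational_Algebra.Primes"
    "Graph_Theory.Graph_Theory"
begin

text \<open>
  As in \<^theory>\<open>Graph_Theory.Digraph\<close>, an undirected simple graph is a loop-free symmetric digraph
  without parallel arcs (locale \<^locale>\<open>graph\<close>), so its connected components are its strongly
  connected components.  The graph notions below are intended for such digraphs.
\<close>

definition delete_verts :: "('a, 'b) pre_digraph \<Rightarrow> 'a set \<Rightarrow> ('a, 'b) pre_digraph" where
  "delete_verts \<Gamma> S = induce_subgraph \<Gamma> (verts \<Gamma> - S)"

text \<open>
  The library's \<^const>\<open>Digraph_Component.connected\<close> is false for the null graph; deleting all
  vertices is not regarded as disconnecting the graph.
\<close>

definition disconnected :: "('a, 'b) pre_digraph \<Rightarrow> bool" where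
  "disconnected \<Gamma> \<longleftrightarrow> verts \<Gamma> \<noteq> {} \<and> \<not> Digraph_Component.connected \<Gamma>"

definition vertex_cutset :: "('a, 'b) pre_digraph \<Rightarrow> 'a set \<Rightarrow> bool" where
  "vertex_cutset \<Gamma> S \<longleftrightarrow> S \<subseteq> verts \<Gamma> \<and> disconnected (delete_verts \<Gamma> S)"

text \<open>
  In a symmetric digraph \<^const>\<open>pre_digraph.cycle\<close> also admits the closed walk of length 2 that
  traverses an edge back and forth; this is not a cycle of the undirected graph.
\<close>

definition contains_cycle :: "('a, 'b) pre_digraph \<Rightarrow> bool" where
  "contains_cycle \<Gamma> \<longleftrightarrow> (\<exists>c. pre_digraph.cycle \<Gamma> c \<and> 3 \<le> length c)"

definition cyclic_vertex_cutset :: "('a, 'b) pre_digraph \<Rightarrow> 'a set \<Rightarrow> bool" where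
  "cyclic_vertex_cutset \<Gamma> S \<longleftrightarrow>
     vertex_cutset \<Gamma> S \<and>
     (\<exists>C \<in> pre_digraph.sccs (delete_verts \<Gamma> S). \<exists>D \<in> pre_digraph.sccs (delete_verts \<Gamma> S).
        C \<noteq> D \<and> contains_cycle C \<and> contains_cycle D)"

definition cyclically_separable :: "('a, 'b) pre_digraph \<Rightarrow> bool" where
  "cyclically_separable \<Gamma> \<longleftrightarrow> (\<exists>S. cyclic_vertex_cutset \<Gamma> S)"


definition is_power_of :: "('a, 'b) monoid_scheme \<Rightarrow> 'a \<Rightarrow> 'a \<Rightarrow> bool" where
  "is_power_of G y x \<longleftrightarrow> (\<exists>k::int. y = x [^]\<^bsub>G\<^esub> k)"

definition power_graph :: "('a, 'b) monoid_scheme \<Rightarrow> ('a, 'a \<times> 'a) pre_digraph" where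
  "power_graph G = with_proj
     \<lparr> pverts = carrier G,
       parcs = {(x, y). x \<in> carrier G \<and> y \<in> carrier G \<and> x \<noteq> y \<and>
                        (is_power_of G x y \<or> is_power_of G y x)} \<rparr>"

lemma graph_power_graph:
  assumes "finite (carrier G)"
  shows "graph (power_graph G)"
proof -
  have "finite {(x, y). x \<in> carrier G \<and> y \<in> carrier G \<and> x \<noteq> y \<and>
                        (is_power_of G x y \<or> is_power_of G y x)}"
    by (rule finite_subset[of _ "carrier G \<times> carrier G"]) (use assms in auto)
  then show ?thesis
    using assms unfolding power_graph_def
    by unfold_locales (auto simp: symmetric_def sym_def arc_to_ends_def)
qed


definition finite_p_group :: "nat \<Rightarrow> ('a, 'b) monoid_scheme \<Rightarrow> bool" where
  "finite_p_group p G \<longleftrightarrow> group G \<and> finite (carrier G) \<and> (\<exists>n. order G = p ^ n)"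

definition cyclic_subgroup :: "'a set \<Rightarrow> ('a, 'b) monoid_scheme \<Rightarrow> bool" where
  "cyclic_subgroup H G \<longleftrightarrow> subgroup H G \<and> cyclic_group (G\<lparr>carrier := H\<rparr>)"

definition maximal_cyclic_subgroups :: "('a, 'b) monoid_scheme \<Rightarrow> 'a set set" where
  "maximal_cyclic_subgroups G =
     {M. cyclic_subgroup M G \<and> \<not> (\<exists>N. cyclic_subgroup N G \<and> M \<subset> N)}"

definition diff_dist :: "'a set \<Rightarrow> 'a set \<Rightarrow> nat" where
  "diff_dist M N = min (card (M - N)) (card (N - M))"

text \<open>For finite groups only: the set below is then finite and nonempty, so the maximum exists.\<close>

definition difference_number :: "('a, 'b) monoid_scheme \<Rightarrow> nat" where
  "difference_number G =
     Max {diff_dist M N | M N. M \<in> maximal_cyclic_subgroups G \<and> N \<in> maximal_cyclic_subgroups G}"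

end

theory Submission
  imports Defs "HOL-Algebra.Multiplicative_Group"
begin

text \<open>
  In a finite \<open>p\<close>-group the elements of a cyclic subgroup form a clique of the power graph, because
  its subgroups form a chain. If \<open>C\<close> and \<open>D\<close> are components containing cycles after deleting vertices,
  a vertex of largest order on a cycle of \<open>C\<close> has its two neighbours in the subgroup it generates, so
  some maximal cyclic subgroup \<open>M\<close> meets \<open>C\<close> in at least three vertices; likewise \<open>N\<close> meets \<open>D\<close>.
  As \<open>M\<close> and \<open>N\<close> are cliques, \<open>C \<inter> M\<close> avoids \<open>N\<close> and \<open>D \<inter> N\<close> avoids \<open>M\<close>. Conversely, no edge joins
  \<open>M - N\<close> to \<open>N - M\<close>, so keeping just these two cliques separates them. The arithmetic conditions
  express when \<open>p\<^sup>a - p\<^sup>c \<ge> 3\<close> for \<open>c < a\<close>.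
\<close>

section \<open>Digraphs\<close>

text \<open>A vertex of the cycle maximizing \<open>f\<close> dominates both its predecessor and its
  successor; length at least 3 makes these two distinct. Later \<open>f\<close> is the size of the
  generated cyclic subgroup.\<close>

lemma (in wf_digraph) cycle_local_maximum:
  fixes f :: "'a \<Rightarrow> nat"
  assumes "cycle c" and "3 \<le> length c"
  obtains u v w where "u \<rightarrow> v" "v \<rightarrow> w" "u \<noteq> v" "v \<noteq> w" "u \<noteq> w" "f u \<le> f v" "f w \<le> f v"
proof -
  define n h where "n = length c" and "h = (\<lambda>i. head G (c ! i))"
  obtain u where walk: "awalk u c u" and dist: "distinct (tl (awalk_verts u c))"
    using assms(1) unfolding cycle_def by auto
  have n: "3 \<le> n" and ne: "c \<noteq> []" using assms(2) by (auto simp: n_def)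
  have cas: "cas u c u" and sub: "set c \<subseteq> arcs G" using walk by auto
  \<comment> \<open>Both sides list the vertices of the walk; comparing entries shows that each arc
    starts where the previous one ends.\<close>
  have eq: "map (tail G) c @ [head G (last c)] = tail G (hd c) # map (head G) c"
    using awalk_verts_conv[of u c] awalk_verts_conv'[OF cas] ne by simp
  have inj: "h i \<noteq> h j" if "i < n" "j < n" "i \<noteq> j" for i j
  proof -
    have "distinct (map (head G) c)"
      using dist ne by (simp add: awalk_verts_conv'[OF cas])
    then show ?thesis
      using that by (auto simp: distinct_conv_nth h_def n_def)
  qed
  have tail_Suc: "tail G (c ! Suc i) = h i" if "Suc i < n" for i
    using arg_cong[OF eq, of "\<lambda>xs. xs ! Suc i"] that
    by (simp add: nth_append h_def n_def)
  have tail_0: "tail G (c ! 0) = h (n - 1)"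
  proof -
    have "tail G (hd c) = u" using cas ne by (simp add: cas_simp)
    moreover have "head G (last c) = u"
      using walk ne awalk_verts_conv[of u c] by auto
    ultimately show ?thesis
      using ne by (simp add: h_def n_def hd_conv_nth last_conv_nth)
  qed
  define i where "i = (ARG_MAX (\<lambda>i. f (h i)) i. i < n)"
  have "0 < n" using n by simp
  \<comment> \<open>\<open>arg_max_nat_lemma\<close> asks for a strict upper bound, hence the
    \<open>Suc\<close> of the maximum.\<close>
  have "\<forall>i<n. f (h i) < Suc (Max ((\<lambda>i. f (h i)) ` {..<n}))"
    by (simp add: less_Suc_eq_le)
  then have i: "i < n" and max: "\<And>j. j < n \<Longrightarrow> f (h j) \<le> f (h i)"
    using arg_max_nat_lemma[of "\<lambda>i. i < n" 0 "\<lambda>i. f (h i)"] \<open>0 < n\<close>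
    unfolding i_def by auto
  \<comment> \<open>Cyclic predecessor and successor of \<open>i\<close>, with wrap-around;
    \<open>3 \<le> n\<close> keeps them apart.\<close>
  define j where "j = (if i = 0 then n - 1 else i - 1)"
  define k where "k = (if Suc i = n then 0 else Suc i)"
  have jk: "j < n" "k < n" "i \<noteq> j" "i \<noteq> k" "j \<noteq> k"
    using i n by (auto simp: j_def k_def)
  have ti: "tail G (c ! i) = h j"
    using tail_0 tail_Suc[of "i - 1"] i by (cases i) (auto simp: j_def)
  have tk: "tail G (c ! k) = h i"
    using tail_0 tail_Suc[of i] i by (auto simp: k_def)
  have arc: "tail G (c ! l) \<rightarrow> h l" if "l < n" for l
    using that sub by (auto simp: h_def n_def intro!: in_arcs_imp_in_arcs_ends)
  show thesis
  proof
    show "h j \<rightarrow> h i" "h i \<rightarrow> h k" using arc[OF i] arc[OF \<open>k < n\<close>] ti tk by auto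
    show "h j \<noteq> h i" "h i \<noteq> h k" "h j \<noteq> h k" using inj jk i by auto
    show "f (h j) \<le> f (h i)" "f (h k) \<le> f (h i)" using max jk by auto
  qed
qed

lemma triangle_contains_cycle:
  assumes "x \<rightarrow>\<^bsub>G\<^esub> y" "y \<rightarrow>\<^bsub>G\<^esub> z" "z \<rightarrow>\<^bsub>G\<^esub> x" "x \<in> verts G" "x \<noteq> y" "y \<noteq> z" "z \<noteq> x"
  shows "contains_cycle G"
proof -
  obtain a b c where "a \<in> arcs G" "b \<in> arcs G" "c \<in> arcs G"
    "tail G a = x" "head G a = y" "tail G b = y" "head G b = z" "tail G c = z" "head G c = x"
    using assms by (auto simp: arcs_ends_def arc_to_ends_def)
  then have "pre_digraph.cycle G [a, b, c]"
    using assms unfolding pre_digraph.cycle_def pre_digraph.awalk_def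
    by (auto simp: pre_digraph.cas.simps pre_digraph.awalk_verts.simps)
  then show ?thesis unfolding contains_cycle_def by force
qed

text \<open>Symmetry turns a single arc into mutual reachability, so both ends lie in one strong
  component.\<close>

lemma (in sym_digraph) adjacent_sccs_eq:
  assumes "C \<in> sccs" "D \<in> sccs" "x \<in> verts C" "y \<in> verts D" "x \<rightarrow> y"
  shows "C = D"
proof -
  have "y \<rightarrow> x" using assms(5) by (rule graph_symmetric)
  then have "x \<rightarrow>\<^sup>* y" "y \<rightarrow>\<^sup>* x" using assms(5) by auto
  moreover have "verts C \<in> sccs_verts" using assms(1) by (simp add: sccs_verts_conv)
  ultimately have "y \<in> verts C"
    using assms(3) unfolding sccs_verts_def by blast
  then show ?thesis using scc_disj[of C D] assms by blast
qed

text \<open>Reachability is mutual in a symmetric digraph, so the induced subgraph is the component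
  of \<open>x\<close>; it contains all three corners.\<close>

lemma (in sym_digraph) triangle_scc:
  assumes "x \<rightarrow> y" "y \<rightarrow> z" "z \<rightarrow> x" "x \<noteq> y" "y \<noteq> z" "z \<noteq> x"
  shows "contains_cycle (G \<restriction> {v. x \<rightarrow>\<^sup>* v})"
proof (rule triangle_contains_cycle)
  have r: "x \<rightarrow>\<^sup>* x" "x \<rightarrow>\<^sup>* y" "x \<rightarrow>\<^sup>* z"
    using assms by (auto intro: reachable_adj_trans)
  have "u \<rightarrow>\<^bsub>G \<restriction> {v. x \<rightarrow>\<^sup>* v}\<^esub> w" if "u \<rightarrow> w" "x \<rightarrow>\<^sup>* u" "x \<rightarrow>\<^sup>* w" for u w
    using that by (auto simp: arcs_ends_def arc_to_ends_def)
  then show "x \<rightarrow>\<^bsub>G \<restriction> {v. x \<rightarrow>\<^sup>* v}\<^esub> y" "y \<rightarrow>\<^bsub>G \<restriction> {v. x \<rightarrow>\<^sup>* v}\<^esub> z" "z \<rightarrow>\<^bsub>G \<restriction> {v. x \<rightarrow>\<^sup>* v}\<^esub> x"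
    using assms r by auto
  show "x \<in> verts (G \<restriction> {v. x \<rightarrow>\<^sup>* v})" using r by simp
qed (use assms in auto)

text \<open>After deleting \<open>S\<close> no arc leads from \<open>A\<close> to \<open>B\<close>,
  so nothing in \<open>B\<close> is reachable from \<open>A\<close>. Three vertices of each clique
  form a triangle, which puts a cycle on either side.\<close>

lemma (in sym_digraph) cyclic_vertex_cutsetI:
  assumes "S \<subseteq> verts G" and "A \<union> B = verts G - S" and "A \<inter> B = {}"
    and "3 \<le> card A" and "3 \<le> card B"
    and clique: "\<And>x y. x \<in> A \<Longrightarrow> y \<in> A \<Longrightarrow> x \<noteq> y \<Longrightarrow> x \<rightarrow> y" "\<And>x y. x \<in> B \<Longrightarrow> y \<in> B \<Longrightarrow> x \<noteq> y \<Longrightarrow> x \<rightarrow> y"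
    and sep: "\<And>x y. x \<in> A \<Longrightarrow> y \<in> B \<Longrightarrow> \<not> x \<rightarrow> y"
  shows "cyclic_vertex_cutset G S"
proof -
  define H where "H = delete_verts G S"
  have ind: "induced_subgraph H G" unfolding H_def delete_verts_def by (rule induced_induce) auto
  interpret H: sym_digraph H by (rule induced_graph_imp_graph[OF ind])
  have verts: "verts H = A \<union> B" using assms(2) by (simp add: H_def delete_verts_def)
  have adj: "x \<rightarrow>\<^bsub>H\<^esub> y \<longleftrightarrow> x \<in> A \<union> B \<and> y \<in> A \<union> B \<and> x \<rightarrow> y" for x y
    unfolding assms(2) H_def delete_verts_def by (auto simp: arcs_ends_def arc_to_ends_def)
  have closed: "y \<in> A" if "x \<rightarrow>\<^sup>*\<^bsub>H\<^esub> y" "x \<in> A" for x y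
    using that
  proof (induction rule: H.reachable_induct)
    case (step y z)
    then show ?case using sep[of y z] adj[of y z] by auto
  qed
  obtain X where "X \<subseteq> A" "card X = 3" using assms(4) by (meson obtain_subset_with_card_n)
  then obtain a a' a'' where a: "a \<in> A" "a' \<in> A" "a'' \<in> A" "a \<noteq> a'" "a' \<noteq> a''" "a'' \<noteq> a"
    by (auto simp: card_3_iff)
  obtain Y where "Y \<subseteq> B" "card Y = 3" using assms(5) by (meson obtain_subset_with_card_n)
  then obtain b b' b'' where b: "b \<in> B" "b' \<in> B" "b'' \<in> B" "b \<noteq> b'" "b' \<noteq> b''" "b'' \<noteq> b"
    by (auto simp: card_3_iff)
  let ?C = "H \<restriction> {v. a \<rightarrow>\<^sup>*\<^bsub>H\<^esub> v}" and ?D = "H \<restriction> {v. b \<rightarrow>\<^sup>*\<^bsub>H\<^esub> v}"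
  have "?C \<in> H.sccs" "?D \<in> H.sccs"
    using a b verts by (auto intro!: H.induce_reachable_is_in_sccs)
  moreover have "contains_cycle ?C" "contains_cycle ?D"
    using a b by (auto intro!: H.triangle_scc[of a a' a''] H.triangle_scc[of b b' b''] simp: adj clique)
  moreover have not_reach: "\<not> a \<rightarrow>\<^sup>*\<^bsub>H\<^esub> b" using closed[of a b] a b assms(3) by auto
  then have "?C \<noteq> ?D"
  proof -
    have "b \<in> verts ?D" "b \<notin> verts ?C" using not_reach b verts by auto
    then show ?thesis by metis
  qed
  moreover have "vertex_cutset G S"
  proof -
    \<comment> \<open>For symmetric digraphs connectedness is strong connectedness, so one
      unreachable pair refutes it.\<close>
    have "\<not> Digraph_Component.connected H"
    proof
      assume "Digraph_Component.connected H"
      then have "strongly_connected H"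
        using H.symmetric_connected_imp_strongly_connected H.sym_arcs by blast
      then show False using not_reach a b verts unfolding strongly_connected_def by auto
    qed
    then show ?thesis
      unfolding vertex_cutset_def disconnected_def H_def[symmetric] using verts a assms(1) by auto
  qed
  ultimately show ?thesis unfolding cyclic_vertex_cutset_def H_def by blast
qed

section \<open>Cyclic subgroups\<close>

lemma (in group) subgroup_generate: "x \<in> carrier G \<Longrightarrow> subgroup (generate G {x}) G"
  by (rule generate_is_subgroup) simp

lemma (in group) generate_singleton_subset_iff:
  assumes "x \<in> carrier G" "subgroup H G"
  shows "generate G {x} \<subseteq> H \<longleftrightarrow> x \<in> H"
  using generate_subgroup_incl[of "{x}" H] generate.incl[of x "{x}" G] assms by auto

lemma (in group) cyclic_subgroup_iff:
  "cyclic_subgroup H G \<longleftrightarrow> (\<exists>x\<in>carrier G. H = generate G {x})"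
proof -
  have "cyclic_group (G\<lparr>carrier := H\<rparr>) \<longleftrightarrow> (\<exists>x\<in>H. H = generate G {x})" if sub: "subgroup H G"
  proof -
    interpret H: group "G\<lparr>carrier := H\<rparr>" using sub by (rule subgroup_imp_group)
    have "range (\<lambda>n::int. x [^]\<^bsub>G\<lparr>carrier := H\<rparr>\<^esub> n) = generate G {x}" if "x \<in> H" for x
      using int_pow_consistent[OF sub that] generate_pow[of x] subgroup.mem_carrier[OF sub that] by auto
    then show ?thesis unfolding H.cyclic_group by auto
  qed
  then show ?thesis
    unfolding cyclic_subgroup_def
    using subgroup_generate generate.incl[of _ "{_}" G] subgroup.mem_carrier by fastforce
qed

lemma (in group) is_power_of_iff:
  "x \<in> carrier G \<Longrightarrow> is_power_of G y x \<longleftrightarrow> y \<in> generate G {x}"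
  by (auto simp: is_power_of_def generate_pow)

text \<open>The subgroup generated by \<open>z [^] a\<close> is governed by the gcd of
  \<open>a\<close> and \<open>ord z\<close>: divisibility of gcds reverses inclusion. All these gcds
  are powers of \<open>p\<close>, hence comparable under divisibility.\<close>

lemma (in group) generate_in_chain:
  assumes z: "z \<in> carrier G" and ord: "ord z = p ^ n" and p: "Factorial_Ring.prime (p::nat)"
    and xy: "x \<in> generate G {z}" "y \<in> generate G {z}"
  shows "x \<in> generate G {y} \<or> y \<in> generate G {x}"
proof -
  have *: "z [^] a \<in> generate G {z [^] b}" if dvd: "gcd b (int (ord z)) dvd a" for a b :: int
  proof -
    obtain u v where "u * b + v * int (ord z) = gcd b (int (ord z))"
      using bezout_int by blast
    then obtain t where t: "a = (u * b + v * int (ord z)) * t" using dvd by (auto simp: dvd_def)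
    \<comment> \<open>By Bezout, \<open>a\<close> agrees modulo \<open>ord z\<close> with a multiple
      of \<open>b\<close>.\<close>
    have "int (ord z) dvd b * (u * t) - a" unfolding t by (simp add: algebra_simps)
    then have "z [^] a = z [^] (b * (u * t))" using z by (simp add: int_pow_eq)
    also have "\<dots> = (z [^] b) [^] (u * t)" using z by (simp add: int_pow_pow)
    finally show ?thesis using z by (auto simp: generate_pow)
  qed
  obtain a b :: int where ab: "x = z [^] a" "y = z [^] b"
    using xy z by (auto simp: generate_pow)
  have "\<exists>i. gcd a (int (ord z)) = int (p ^ i)" for a :: int
  proof -
    have "nat (gcd a (int (ord z))) dvd p ^ n"
      by (metis gcd_dvd2 gcd_ge_0_int int_nat_eq int_dvd_int_iff ord)
    then obtain i where "nat (gcd a (int (ord z))) = p ^ i"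
      using divides_primepow_nat[OF p] by auto
    then show ?thesis by (metis gcd_ge_0_int int_nat_eq)
  qed
  then obtain i j where ij: "gcd a (int (ord z)) = int (p ^ i)" "gcd b (int (ord z)) = int (p ^ j)"
    by meson
  have "i \<le> j \<or> j \<le> i" by auto
  then have "gcd a (int (ord z)) dvd gcd b (int (ord z)) \<or> gcd b (int (ord z)) dvd gcd a (int (ord z))"
    unfolding ij by (auto intro: le_imp_power_dvd)
  then show ?thesis unfolding ab using * by (meson dvd_trans gcd_dvd1)
qed

lemma (in group) ex_maximal_cyclic_subgroup:
  assumes "finite (carrier G)" "x \<in> carrier G"
  shows "\<exists>M\<in>maximal_cyclic_subgroups G. x \<in> M"
proof -
  let ?A = "{M. cyclic_subgroup M G}"
  have "?A \<subseteq> Pow (carrier G)" by (auto simp: cyclic_subgroup_def dest: subgroup.mem_carrier)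
  then have "finite ?A" using assms(1) by (meson finite_Pow_iff finite_subset)
  moreover have "generate G {x} \<in> ?A" using assms(2) by (auto simp: cyclic_subgroup_iff)
  ultimately obtain M where M: "M \<in> ?A" "generate G {x} \<subseteq> M" "\<forall>N\<in>?A. M \<subseteq> N \<longrightarrow> M = N"
    by (meson finite_has_maximal2)
  then have "M \<in> maximal_cyclic_subgroups G" by (auto simp: maximal_cyclic_subgroups_def)
  moreover have "x \<in> M" using M(2) generate.incl[of x "{x}" G] by auto
  ultimately show ?thesis by blast
qed

lemma (in group) maximal_cyclic_subgroupE:
  assumes "M \<in> maximal_cyclic_subgroups G"
  obtains x where "x \<in> carrier G" "M = generate G {x}"
  using assms cyclic_subgroup_iff by (auto simp: maximal_cyclic_subgroups_def)

lemma maximal_cyclic_subgroup_subgroup: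
  "M \<in> maximal_cyclic_subgroups G \<Longrightarrow> subgroup M G"
  by (auto simp: maximal_cyclic_subgroups_def cyclic_subgroup_def)

lemma maximal_cyclic_subgroups_not_subset:
  "\<lbrakk>M \<in> maximal_cyclic_subgroups G; N \<in> maximal_cyclic_subgroups G; M \<noteq> N\<rbrakk> \<Longrightarrow> \<not> M \<subseteq> N"
  by (auto simp: maximal_cyclic_subgroups_def)

text \<open>In a cyclic group the carrier is the only maximal cyclic subgroup. Conversely every
  element lies in some maximal cyclic subgroup, so a unique one exhausts the group.\<close>

lemma (in group) not_cyclic_iff:
  assumes "finite (carrier G)"
  shows "\<not> cyclic_group G \<longleftrightarrow>
    (\<exists>M \<in> maximal_cyclic_subgroups G. \<exists>N \<in> maximal_cyclic_subgroups G. M \<noteq> N)"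
proof -
  have cyc: "cyclic_group G \<longleftrightarrow> cyclic_subgroup (carrier G) G"
    by (simp add: cyclic_subgroup_def subgroup_self)
  have "M = carrier G" if "cyclic_group G" "M \<in> maximal_cyclic_subgroups G" for M
    using that maximal_cyclic_subgroup_subgroup[OF that(2)] unfolding cyc
    by (auto simp: maximal_cyclic_subgroups_def dest: subgroup.subset)
  moreover have "cyclic_group G"
    if uniq: "\<And>M N. M \<in> maximal_cyclic_subgroups G \<Longrightarrow> N \<in> maximal_cyclic_subgroups G \<Longrightarrow> M = N"
  proof -
    obtain M where M: "M \<in> maximal_cyclic_subgroups G"
      using ex_maximal_cyclic_subgroup[OF assms one_closed] by blast
    have "M = carrier G"
      using ex_maximal_cyclic_subgroup[OF assms] uniq[OF M] maximal_cyclic_subgroup_subgroup[OF M]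
      by (auto dest: subgroup.mem_carrier)
    then show ?thesis unfolding cyc using M by (simp add: maximal_cyclic_subgroups_def)
  qed
  ultimately show ?thesis by metis
qed

text \<open>The set under \<open>Max\<close> is finite and nonempty, so the maximum is attained by
  some pair.\<close>

lemma (in group) difference_number_ge_iff:
  assumes "finite (carrier G)"
  shows "k \<le> difference_number G \<longleftrightarrow>
    (\<exists>M \<in> maximal_cyclic_subgroups G. \<exists>N \<in> maximal_cyclic_subgroups G. k \<le> diff_dist M N)"
proof -
  let ?M = "maximal_cyclic_subgroups G"
  have "?M \<subseteq> Pow (carrier G)"
    by (auto dest!: maximal_cyclic_subgroup_subgroup dest: subgroup.mem_carrier)
  then have "finite ?M" using assms by (meson finite_Pow_iff finite_subset)
  then have fin: "finite ((\<lambda>(M, N). diff_dist M N) ` (?M \<times> ?M))" by simp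
  have eq: "{diff_dist M N | M N. M \<in> ?M \<and> N \<in> ?M} = (\<lambda>(M, N). diff_dist M N) ` (?M \<times> ?M)"
    by auto
  have "?M \<noteq> {}" using ex_maximal_cyclic_subgroup[OF assms one_closed] by blast
  then show ?thesis unfolding difference_number_def eq using Max_ge_iff[OF fin] by auto
qed

section \<open>Power graphs\<close>

lemma (in group) verts_delete_power_graph [simp]:
  "verts (delete_verts (power_graph G) S) = carrier G - S"
  by (simp add: delete_verts_def power_graph_def)

lemma (in group) adj_power_graph_iff:
  "x \<rightarrow>\<^bsub>power_graph G\<^esub> y \<longleftrightarrow> x \<in> carrier G \<and> y \<in> carrier G \<and> x \<noteq> y \<and>
    (x \<in> generate G {y} \<or> y \<in> generate G {x})"
  by (auto simp: power_graph_def arcs_ends_def arc_to_ends_def is_power_of_iff)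

lemma (in group) adj_delete_power_graph_iff:
  "x \<rightarrow>\<^bsub>delete_verts (power_graph G) S\<^esub> y \<longleftrightarrow>
    x \<in> carrier G - S \<and> y \<in> carrier G - S \<and> x \<rightarrow>\<^bsub>power_graph G\<^esub> y"
  by (auto simp: power_graph_def delete_verts_def arcs_ends_def arc_to_ends_def)

lemma (in group) scc_with_cycle:
  assumes fin: "finite (carrier G)"
    and C: "C \<in> pre_digraph.sccs (delete_verts (power_graph G) S)" and "contains_cycle C"
  obtains M where "M \<in> maximal_cyclic_subgroups G" "3 \<le> card (verts C \<inter> M)"
proof -
  define H where "H = delete_verts (power_graph G) S"
  have ind: "induced_subgraph C H" using C by (simp add: H_def pre_digraph.sccs_def)
  interpret C: wf_digraph C using ind by (auto simp: induced_subgraph_def subgraph_def)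
  obtain c where "C.cycle c" "3 \<le> length c" using assms(3) by (auto simp: contains_cycle_def)
  then obtain u v w where uvw: "u \<rightarrow>\<^bsub>C\<^esub> v" "v \<rightarrow>\<^bsub>C\<^esub> w" "u \<noteq> v" "v \<noteq> w" "u \<noteq> w"
    "card (generate G {u}) \<le> card (generate G {v})" "card (generate G {w}) \<le> card (generate G {v})"
    by (rule C.cycle_local_maximum[where f = "\<lambda>x. card (generate G {x})"])
  have lift: "x \<rightarrow>\<^bsub>power_graph G\<^esub> y" if "x \<rightarrow>\<^bsub>C\<^esub> y" for x y
  proof -
    have "x \<rightarrow>\<^bsub>H\<^esub> y"
      using that ind by (meson induced_imp_subgraph pre_digraph.adj_mono)
    then show ?thesis by (simp add: H_def adj_delete_power_graph_iff)
  qed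
  \<comment> \<open>An arc gives membership in one direction; if it is \<open>y\<close> that lies in
    \<open>generate G {x}\<close>, comparing cardinalities forces the two generated subgroups to
    coincide.\<close>
  have below: "x \<in> generate G {y}" if "x \<rightarrow>\<^bsub>power_graph G\<^esub> y \<or> y \<rightarrow>\<^bsub>power_graph G\<^esub> x"
      and le: "card (generate G {x}) \<le> card (generate G {y})" for x y
  proof -
    have xy: "x \<in> carrier G" "y \<in> carrier G" "x \<in> generate G {y} \<or> y \<in> generate G {x}"
      using that(1) by (auto simp: adj_power_graph_iff)
    have "x \<in> generate G {y}" if "y \<in> generate G {x}"
    proof -
      have "generate G {y} \<subseteq> generate G {x}"
        using that xy by (simp add: generate_singleton_subset_iff subgroup_generate)
      moreover have "finite (generate G {x})"
        using fin xy(1) generate_incl[of "{x}"] by (auto intro: finite_subset)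
      ultimately have "generate G {y} = generate G {x}" using le by (simp add: card_seteq)
      then show ?thesis using generate.incl[of x "{x}" G] by simp
    qed
    then show ?thesis using xy(3) by blast
  qed
  have "v \<in> carrier G" using lift[OF uvw(1)] by (simp add: adj_power_graph_iff)
  then obtain M where M: "M \<in> maximal_cyclic_subgroups G" "v \<in> M"
    using ex_maximal_cyclic_subgroup[OF fin] by blast
  have sub: "subgroup M G" using M(1) by (rule maximal_cyclic_subgroup_subgroup)
  have "generate G {v} \<subseteq> M"
    using M(2) \<open>v \<in> carrier G\<close> sub by (simp add: generate_singleton_subset_iff)
  moreover have "u \<in> generate G {v}" "w \<in> generate G {v}"
    using below lift uvw by blast+
  ultimately have "{u, v, w} \<subseteq> verts C \<inter> M"
    using uvw(1,2) M(2) by (auto dest: C.adj_in_verts)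
  moreover have "finite (verts C \<inter> M)" using sub fin by (meson finite_Int finite_subset subgroup.subset)
  ultimately have "card {u, v, w} \<le> card (verts C \<inter> M)" by (rule card_mono[rotated])
  then show thesis using uvw M(1) that by simp
qed

section \<open>Finite p-groups: separability and the arithmetic of the difference number\<close>

locale finite_p_grp = group G for G (structure) +
  fixes p :: nat
  assumes prime: "Factorial_Ring.prime p" and finite: "finite (carrier G)"
    and order: "\<exists>n. order G = p ^ n"
begin

lemma card_subgroup_primepow: "subgroup H G \<Longrightarrow> \<exists>n. card H = p ^ n"
proof -
  assume "subgroup H G"
  then have "card H dvd order G" using lagrange by (metis dvd_triv_right)
  then show ?thesis using order divides_primepow_nat[OF prime] by metis
qed

text \<open>By Lagrange the order of a generator is a power of \<open>p\<close>, so
  \<open>generate_in_chain\<close> applies. This makes maximal cyclic subgroups cliques of the power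
  graph.\<close>

lemma maximal_cyclic_subgroup_chain:
  assumes "M \<in> maximal_cyclic_subgroups G" "x \<in> M" "y \<in> M"
  shows "x \<in> generate G {y} \<or> y \<in> generate G {x}"
proof -
  obtain z where z: "z \<in> carrier G" "M = generate G {z}"
    using assms(1) by (rule maximal_cyclic_subgroupE)
  obtain n where "ord z = p ^ n"
    using card_subgroup_primepow[OF subgroup_generate[OF z(1)]] generate_pow_card[OF z(1)] by auto
  then show ?thesis using generate_in_chain[OF z(1) _ prime] assms(2,3) z(2) by blast
qed

lemma cyclically_separable_iff:
  "cyclically_separable (power_graph G) \<longleftrightarrow> 3 \<le> difference_number G"
proof
  interpret P: graph "power_graph G" using finite by (rule graph_power_graph)
  assume "cyclically_separable (power_graph G)"
  then obtain S C D where CD: "C \<in> pre_digraph.sccs (delete_verts (power_graph G) S)"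
      "D \<in> pre_digraph.sccs (delete_verts (power_graph G) S)" "C \<noteq> D"
      "contains_cycle C" "contains_cycle D"
    by (auto simp: cyclically_separable_def cyclic_vertex_cutset_def)
  define H where "H = delete_verts (power_graph G) S"
  have "induced_subgraph H (power_graph G)"
    unfolding H_def delete_verts_def by (rule P.induced_induce) auto
  then interpret H: sym_digraph H by (rule P.induced_graph_imp_graph)
  obtain M where M: "M \<in> maximal_cyclic_subgroups G" "3 \<le> card (verts C \<inter> M)"
    using scc_with_cycle[OF finite CD(1,4)] .
  obtain N where N: "N \<in> maximal_cyclic_subgroups G" "3 \<le> card (verts D \<inter> N)"
    using scc_with_cycle[OF finite CD(2,5)] .
  \<comment> \<open>A maximal cyclic subgroup meeting both components would supply an arc between
    them.\<close>
  have disj: False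
    if "X \<in> maximal_cyclic_subgroups G" "x \<in> X" "y \<in> X" "x \<in> verts C" "y \<in> verts D" for x y X
  proof -
    have v: "verts C \<subseteq> verts H" "verts D \<subseteq> verts H"
      using CD(1,2) by (auto simp: H_def pre_digraph.sccs_def induced_subgraph_def subgraph_def)
    have "verts C \<inter> verts D = {}" using H.scc_disj CD by (simp add: H_def)
    then have "x \<noteq> y" using that by blast
    then have "x \<rightarrow>\<^bsub>H\<^esub> y"
      using maximal_cyclic_subgroup_chain[OF that(1-3)] that(4,5) v
      by (auto simp: H_def adj_delete_power_graph_iff adj_power_graph_iff)
    then show False using H.adjacent_sccs_eq CD that(4,5) by (auto simp: H_def)
  qed
  have nonempty: "verts C \<inter> M \<noteq> {}" "verts D \<inter> N \<noteq> {}" using M(2) N(2) by auto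
  have fin: "finite M" "finite N"
    using M(1) N(1) finite maximal_cyclic_subgroup_subgroup subgroup.subset finite_subset by metis+
  \<comment> \<open>\<open>N\<close> already contains a vertex of \<open>D\<close>, so by
    \<open>disj\<close> it contains none of \<open>C\<close>.\<close>
  have "verts C \<inter> M \<subseteq> M - N" using disj[OF N(1)] nonempty(2) by blast
  then have "3 \<le> card (M - N)" using M(2) fin by (meson card_mono finite_Diff le_trans)
  moreover have "verts D \<inter> N \<subseteq> N - M" using disj[OF M(1)] nonempty(1) by blast
  then have "3 \<le> card (N - M)" using N(2) fin by (meson card_mono finite_Diff le_trans)
  ultimately show "3 \<le> difference_number G"
    unfolding difference_number_ge_iff[OF finite] diff_dist_def using M(1) N(1) by auto
next
  interpret P: graph "power_graph G" using finite by (rule graph_power_graph)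
  assume "3 \<le> difference_number G"
  then obtain M N where MN: "M \<in> maximal_cyclic_subgroups G" "N \<in> maximal_cyclic_subgroups G"
      "3 \<le> card (M - N)" "3 \<le> card (N - M)"
    unfolding difference_number_ge_iff[OF finite] diff_dist_def by auto
  have sub: "subgroup M G" "subgroup N G" using MN(1,2) by (auto intro: maximal_cyclic_subgroup_subgroup)
  have car: "M \<subseteq> carrier G" "N \<subseteq> carrier G" using sub by (auto dest: subgroup.subset)
  have verts: "verts (power_graph G) = carrier G" by (simp add: power_graph_def)
  have clique: "x \<rightarrow>\<^bsub>power_graph G\<^esub> y"
    if "X \<in> maximal_cyclic_subgroups G" "x \<in> X" "y \<in> X" "x \<noteq> y" for x y X
    using maximal_cyclic_subgroup_chain[OF that(1-3)] that maximal_cyclic_subgroup_subgroup[OF that(1)]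
    by (auto simp: adj_power_graph_iff dest: subgroup.mem_carrier)
  \<comment> \<open>The powers of \<open>x\<close> stay in \<open>M\<close> and those of
    \<open>y\<close> in \<open>N\<close>, so neither is a power of the other.\<close>
  have sep: "\<not> x \<rightarrow>\<^bsub>power_graph G\<^esub> y" if "x \<in> M - N" "y \<in> N - M" for x y
  proof
    assume "x \<rightarrow>\<^bsub>power_graph G\<^esub> y"
    then have "x \<in> generate G {y} \<or> y \<in> generate G {x}" by (simp add: adj_power_graph_iff)
    moreover have "generate G {y} \<subseteq> N" "generate G {x} \<subseteq> M"
      using that sub car by (simp_all add: generate_singleton_subset_iff subsetD)
    ultimately show False using that by blast
  qed
  \<comment> \<open>The cutset is the complement of the symmetric difference of \<open>M\<close> and
    \<open>N\<close>, leaving just the two cliques.\<close>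
  have "cyclic_vertex_cutset (power_graph G) (carrier G - ((M - N) \<union> (N - M)))"
    by (rule P.cyclic_vertex_cutsetI[where A = "M - N" and B = "N - M"])
      (use MN car clique[OF MN(1)] clique[OF MN(2)] sep in \<open>auto simp: verts\<close>)
  then show "cyclically_separable (power_graph G)" unfolding cyclically_separable_def by blast
qed

text \<open>By Lagrange \<open>H - K\<close> has \<open>p ^ a - p ^ c\<close> elements for some
  \<open>c < a\<close>. This is at least \<open>(p - 1) * p ^ (a - 1)\<close>, so only small orders
  with \<open>p \<le> 3\<close> need inspection.\<close>

lemma card_diff_ge_3_iff:
  assumes "subgroup H G" "subgroup K G" "\<not> H \<subseteq> K"
  shows "3 \<le> card (H - K) \<longleftrightarrow>
    p > 3 \<or> p = 3 \<and> card H > 3 \<or> p = 2 \<and> (card H > 4 \<or> card H > 2 \<and> H \<inter> K = {\<one>})"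
proof -
  have fin: "finite H" using assms(1) finite by (meson finite_subset subgroup.subset)
  have sub: "subgroup (H \<inter> K) G" using assms by (simp add: subgroups_Inter_pair)
  obtain a c where ac: "card H = p ^ a" "card (H \<inter> K) = p ^ c"
    using card_subgroup_primepow[OF assms(1)] card_subgroup_primepow[OF sub] by auto
  have p: "2 \<le> p" using prime prime_ge_2_nat by blast
  have "H \<inter> K \<subset> H" using assms(3) by blast
  then have "p ^ c < p ^ a" using psubset_card_mono[OF fin] ac by metis
  then have "c < a" using p by (meson not_less power_increasing le_trans one_le_numeral)
  have card: "card (H - K) = p ^ a - p ^ c"
    using card_Diff_subset_Int[of H K] fin ac by simp
  have triv: "H \<inter> K = {\<one>} \<longleftrightarrow> p ^ c = 1"
  proof
    assume "p ^ c = 1"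
    moreover have "\<one> \<in> H \<inter> K" using sub by (rule subgroup.one_closed)
    ultimately show "H \<inter> K = {\<one>}" using ac(2) by (metis card_1_singletonE singletonD)
  qed (use ac(2) in simp)
  \<comment> \<open>\<open>b\<close> is the largest exponent open to \<open>c\<close>; replacing
    \<open>p ^ c\<close> by \<open>p ^ b\<close> gives the smallest possible difference.\<close>
  obtain b where b: "a = Suc b" "c \<le> b" using \<open>c < a\<close> by (cases a) auto
  have pcb: "p ^ c \<le> p ^ b" using b(2) p by (simp add: power_increasing)
  consider "p > 3" | "p = 3" | "p = 2" using p by linarith
  then show ?thesis
  proof cases
    case 1
    then have "4 * p ^ b \<le> p ^ a" "1 \<le> p ^ b" using b by auto
    then have "3 \<le> p ^ a - p ^ c" using pcb by linarith
    then show ?thesis using card 1 by simp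
  next
    case 2
    show ?thesis
    proof (cases b)
      \<comment> \<open>\<open>H\<close> has order 3 and meets \<open>K\<close> trivially: two
        elements remain and both sides fail.\<close>
      case 0
      then show ?thesis using 2 card ac(1) b by simp
    next
      case (Suc d)
      have "1 \<le> (3::nat) ^ d" by simp
      moreover have "p ^ a = 9 * 3 ^ d" "p ^ b = 3 * 3 ^ d" using 2 Suc by (simp_all add: b(1))
      ultimately have "3 < p ^ a" "3 \<le> p ^ a - p ^ c" using pcb by linarith+
      then show ?thesis using 2 unfolding card ac(1) by simp
    qed
  next
    case 3
    consider "b = 0" | "b = 1" | d where "b = Suc (Suc d)" by (metis One_nat_def not0_implies_Suc)
    then show ?thesis
    proof cases
      \<comment> \<open>\<open>H\<close> has order 2: a single element remains and both sides
        fail.\<close>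
      case 1
      then show ?thesis using 3 card ac(1) b by simp
    next
      \<comment> \<open>\<open>H\<close> has order 4: three elements remain for
        \<open>c = 0\<close>, two for \<open>c = 1\<close>, so trivial intersection decides.\<close>
      case 2
      then have "c = 0 \<or> c = 1" using b(2) by auto
      then show ?thesis using 3 2 card ac(1) b(1) triv by auto
    next
      \<comment> \<open>\<open>H\<close> has order at least 8, and at least half of it lies outside
        \<open>K\<close>.\<close>
      case (3 d)
      have "1 \<le> (2::nat) ^ d" by simp
      moreover have "p ^ a = 8 * 2 ^ d" "p ^ b = 4 * 2 ^ d" using 3 \<open>p = 2\<close> by (simp_all add: b(1))
      ultimately have "4 < p ^ a" "3 \<le> p ^ a - p ^ c" using pcb by linarith+
      then show ?thesis using \<open>p = 2\<close> unfolding card ac(1) by simp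
    qed
  qed
qed

text \<open>Distinct maximal cyclic subgroups do not contain each other, so
  \<open>card_diff_ge_3_iff\<close> applies to \<open>M - N\<close> and to \<open>N - M\<close>; the
  minimum is at least 3 when both differences are.\<close>

lemma difference_number_ge_3_iff:
  "3 \<le> difference_number G \<longleftrightarrow>
    (p > 3 \<and> \<not> cyclic_group G) \<or>
    (p = 3 \<and>
      (\<exists>M \<in> maximal_cyclic_subgroups G. \<exists>N \<in> maximal_cyclic_subgroups G.
        M \<noteq> N \<and> card M > 3 \<and> card N > 3)) \<or>
    (p = 2 \<and>
      ((\<exists>M \<in> maximal_cyclic_subgroups G. \<exists>N \<in> maximal_cyclic_subgroups G.
         M \<noteq> N \<and> card M > 4 \<and> card N > 4) \<or>
       (\<exists>M \<in> maximal_cyclic_subgroups G. \<exists>N \<in> maximal_cyclic_subgroups G.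
         M \<noteq> N \<and> card M > 2 \<and> card N > 2 \<and> M \<inter> N = {\<one>})))"
proof -
  let ?M = "maximal_cyclic_subgroups G"
  have "2 \<le> p" using prime prime_ge_2_nat by blast
  have pair: "3 \<le> diff_dist M N \<longleftrightarrow> M \<noteq> N \<and>
      (p > 3 \<or> p = 3 \<and> card M > 3 \<and> card N > 3 \<or>
       p = 2 \<and> (card M > 4 \<and> card N > 4 \<or> card M > 2 \<and> card N > 2 \<and> M \<inter> N = {\<one>}))"
    if "M \<in> ?M" "N \<in> ?M" for M N
  proof (cases "M = N")
    case False
    then have "\<not> M \<subseteq> N" "\<not> N \<subseteq> M" using that maximal_cyclic_subgroups_not_subset by metis+
    then have diff: "3 \<le> card (M - N) \<longleftrightarrow> p > 3 \<or> p = 3 \<and> card M > 3 \<or>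
          p = 2 \<and> (card M > 4 \<or> card M > 2 \<and> M \<inter> N = {\<one>})"
        "3 \<le> card (N - M) \<longleftrightarrow> p > 3 \<or> p = 3 \<and> card N > 3 \<or>
          p = 2 \<and> (card N > 4 \<or> card N > 2 \<and> M \<inter> N = {\<one>})"
      using card_diff_ge_3_iff[of M N] card_diff_ge_3_iff[of N M] that
      by (simp_all only: maximal_cyclic_subgroup_subgroup Int_commute[of N M] simp_thms)
    \<comment> \<open>For \<open>p = 2\<close> one subgroup may satisfy the bound 4 while the other
      has only the bound 2 with trivial intersection; weakening the former puts the pair under the
      second alternative.\<close>
    have gt: "4 < card M \<Longrightarrow> 2 < card M" "4 < card N \<Longrightarrow> 2 < card N" by simp_all
    consider "p > 3" | "p = 3" | "p = 2" using \<open>2 \<le> p\<close> by linarith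
    then show ?thesis
      unfolding diff_dist_def min.bounded_iff diff using False
      by cases (simp, simp, use gt in \<open>simp, blast\<close>)
  qed (simp add: diff_dist_def)
  consider "p > 3" | "p = 3" | "p = 2" using \<open>2 \<le> p\<close> by linarith
  then show ?thesis
  proof cases
    case 1
    then show ?thesis
      unfolding difference_number_ge_iff[OF finite] not_cyclic_iff[OF finite] using pair by simp
  next
    case 2
    then show ?thesis
      unfolding difference_number_ge_iff[OF finite] using pair by simp
  next
    case 3
    then have "3 \<le> diff_dist M N \<longleftrightarrow> M \<noteq> N \<and> card M > 4 \<and> card N > 4 \<or>
        M \<noteq> N \<and> card M > 2 \<and> card N > 2 \<and> M \<inter> N = {\<one>}"
      if "M \<in> ?M" "N \<in> ?M" for M N
      using pair[OF that] by (simp, blast)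
    then have "3 \<le> difference_number G \<longleftrightarrow>
        (\<exists>M \<in> ?M. \<exists>N \<in> ?M. M \<noteq> N \<and> card M > 4 \<and> card N > 4 \<or>
          M \<noteq> N \<and> card M > 2 \<and> card N > 2 \<and> M \<inter> N = {\<one>})"
      unfolding difference_number_ge_iff[OF finite] by simp
    \<comment> \<open>Existential quantifiers distribute over the disjunction, which splits the
      condition on pairs into two separate alternatives.\<close>
    then show ?thesis using 3 by (simp only: bex_disj_distrib) simp
  qed
qed

end

theorem theorem1p1:
  fixes p :: nat and G :: "('a, 'b) monoid_scheme"
  assumes "Factorial_Ring.prime p"
    and "finite_p_group p G"
  shows "(cyclically_separable (power_graph G) \<longleftrightarrow> difference_number G \<ge> 3) \<and>
    (difference_number G \<ge> 3 \<longleftrightarrow>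
      (p > 3 \<and> \<not> cyclic_group G) \<or>
      (p = 3 \<and>
        (\<exists>M \<in> maximal_cyclic_subgroups G. \<exists>N \<in> maximal_cyclic_subgroups G.
          M \<noteq> N \<and> card M > 3 \<and> card N > 3)) \<or>
      (p = 2 \<and>
        ((\<exists>M \<in> maximal_cyclic_subgroups G. \<exists>N \<in> maximal_cyclic_subgroups G.
           M \<noteq> N \<and> card M > 4 \<and> card N > 4) \<or>
         (\<exists>M \<in> maximal_cyclic_subgroups G. \<exists>N \<in> maximal_cyclic_subgroups G.
           M \<noteq> N \<and> card M > 2 \<and> card N > 2 \<and> M \<inter> N = {\<one>\<^bsub>G\<^esub>}))))"
proof -
  interpret finite_p_grp G p
    using assms unfolding finite_p_group_def
    by (intro finite_p_grp.intro finite_p_grp_axioms.intro) simp_all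
  show ?thesis by (intro conjI cyclically_separable_iff difference_number_ge_3_iff)
qed

end
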